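(* There is a universal constant $c>0$ such that for all integers $N\ge 2$, all $\varepsilon\in(0,1/2)$ and all $\delta\in(0,1)$, every algorithm that solves $\mathsf{QPE}_{N,\delta,\varepsilon}$ has cost at least $c\,\frac1\delta\log\frac1\varepsilon$ (i.e. cost $\Omega\left(\frac1\delta\log\frac1\varepsilon\right)$).
   Context: Model of computation. The input is an unknown $N$-dimensional unitary $U$. The state space is $\mathbb{C}^N\otimes W$, where the first register is $N$-dimensional and $W$ is an arbitrarily large (finite-dimensional) workspace. The algorithm may apply $U$ and $U^{-1}$ to the first register (possibly controlled by a qubit of the workspace), and arbitrary unitaries independent of $U$ to the whole space; at the end it performs a POVM (independent of $U$) which determines the classical output. The cost of the algorithm is the total number of applications of $U$ and $U^{-1}$ (including controlled versions); all other operations are free. Logarithms are base 2. The task $\mathsf{QPE}_{N,\delta,\varepsilon}$ (phase estimation): the algorithm is given one copy of a state $|\psi\rangle\in\mathbb{C}^N$, i.e. its starting state is $|\psi\rangle|0\rangle$, with the promise that $U|\psi\rangle=e^{i\theta}|\psi\rangle$ for some unknown $\theta\in[0,2\pi)$. With probability at least $1-\varepsilon$ it must output $\tilde\theta\in[0,2\pi)$ such that $|\tilde\theta-\theta|\le\delta$ modulo $2\pi$ (distance on the circle $\mathbb{R}/2\pi\mathbb{Z}$). This must hold for every such $U$ and $|\psi\rangle$. *)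

theory Defs
  imports "HOL-Analysis.Analysis" "Jordan_Normal_Form.Schur_Decomposition"
begin

hide_type (open) Finite_Cartesian_Product.vec
hide_const (open) Finite_Cartesian_Product.vec Finite_Cartesian_Product.vec_nth
no_notation Finite_Cartesian_Product.vec_nth (infixl "$" 90)

section \<open>Linear algebra\<close>

text \<open>Kronecker products, with the left factor as the major index: the basis vector
  \<open>|i\<rangle>|j\<rangle>\<close> of \<open>\<complex>\<^sup>m \<otimes> \<complex>\<^sup>n\<close> has index \<open>i * n + j\<close>.\<close>

definition kron :: "complex mat \<Rightarrow> complex mat \<Rightarrow> complex mat" where
  "kron A B = Matrix.mat (dim_row A * dim_row B) (dim_col A * dim_col B)
     (\<lambda>(i, j). A $$ (i div dim_row B, j div dim_col B) * B $$ (i mod dim_row B, j mod dim_col B))"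

definition kron_vec :: "complex Matrix.vec \<Rightarrow> complex Matrix.vec \<Rightarrow> complex Matrix.vec" where
  "kron_vec u v = Matrix.vec (dim_vec u * dim_vec v)
     (\<lambda>i. vec_index u (i div dim_vec v) * vec_index v (i mod dim_vec v))"

definition unitary_mat :: "nat \<Rightarrow> complex mat \<Rightarrow> bool" where
  "unitary_mat n U \<longleftrightarrow> U \<in> carrier_mat n n \<and>
     mat_adjoint U * U = 1\<^sub>m n \<and> U * mat_adjoint U = 1\<^sub>m n"

text \<open>Below, \<open>0 \<le> z\<close> for complex \<open>z\<close> says that \<open>z\<close> is real and nonnegative, and
  \<open>(E *\<^sub>v v) \<bullet>c v\<close> is \<open>\<langle>v|E|v\<rangle>\<close>.\<close>

definition positive_op :: "nat \<Rightarrow> complex mat \<Rightarrow> bool" where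
  "positive_op n E \<longleftrightarrow> E \<in> carrier_mat n n \<and>
     (\<forall>v\<in>carrier_vec n. 0 \<le> (E *\<^sub>v v) \<bullet>c v)"

text \<open>Positive operator-valued measures on the measurable space underlying \<open>M\<close> (the measure
  of \<open>M\<close> itself plays no role). In finite dimension, entrywise convergence in the
  countable additivity clause is the same as weak or norm convergence.\<close>

definition povm :: "'a measure \<Rightarrow> nat \<Rightarrow> ('a set \<Rightarrow> complex mat) \<Rightarrow> bool" where
  "povm M n E \<longleftrightarrow>
     (\<forall>S\<in>sets M. positive_op n (E S)) \<and>
     E (space M) = 1\<^sub>m n \<and>
     (\<forall>A :: nat \<Rightarrow> 'a set. range A \<subseteq> sets M \<and> disjoint_family A \<longrightarrow>
        (\<forall>i<n. \<forall>j<n. (\<lambda>k. E (A k) $$ (i, j)) sums (E (\<Union>k. A k) $$ (i, j))))"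

section \<open>Query algorithms\<close>

text \<open>A query \<open>Query invq ctrl\<close> applies the input unitary (\<open>invq = False\<close>) or its inverse
  (\<open>invq = True\<close>) to the first register. With \<open>ctrl = None\<close> it is uncontrolled;
  with \<open>ctrl = Some (a, b)\<close> it is controlled by the qubit of the workspace
  that is the middle factor in \<open>W = \<complex>\<^sup>a \<otimes> \<complex>\<^sup>2 \<otimes> \<complex>\<^sup>b\<close>.\<close>

datatype gate =
    Free "complex mat"
  | Query bool "(nat \<times> nat) option"

text \<open>An algorithm is its workspace dimension, its gates in the order in which they are
  applied, and the final measurement, a POVM whose outcome is the output.\<close>

record query_alg =
  wdim :: nat
  gates :: "gate list"
  meas :: "real set \<Rightarrow> complex mat"

definition angle_space :: "real measure" where
  "angle_space = restrict_space borel {0..<2 * pi}"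

fun valid_gate :: "nat \<Rightarrow> nat \<Rightarrow> gate \<Rightarrow> bool" where
  "valid_gate N w (Free V) \<longleftrightarrow> unitary_mat (N * w) V"
| "valid_gate N w (Query invq None) \<longleftrightarrow> True"
| "valid_gate N w (Query invq (Some (a, b))) \<longleftrightarrow> a * 2 * b = w"

definition query_algorithm :: "nat \<Rightarrow> query_alg \<Rightarrow> bool" where
  "query_algorithm N \<A> \<longleftrightarrow>
     wdim \<A> > 0 \<and>
     (\<forall>g\<in>set (gates \<A>). valid_gate N (wdim \<A>) g) \<and>
     povm angle_space (N * wdim \<A>) (meas \<A>)"

fun is_query :: "gate \<Rightarrow> bool" where
  "is_query (Free V) \<longleftrightarrow> False"
| "is_query (Query invq ctrl) \<longleftrightarrow> True"

definition cost :: "query_alg \<Rightarrow> nat" where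
  "cost \<A> = length (filter is_query (gates \<A>))"

text \<open>The projector \<open>|b\<rangle>\<langle>b|\<close> on a qubit.\<close>

definition qubit_proj :: "nat \<Rightarrow> complex mat" where
  "qubit_proj b = Matrix.mat 2 2 (\<lambda>(i, j). if i = b \<and> j = b then 1 else 0)"

text \<open>As the input is unitary, its adjoint is its inverse.\<close>

definition queried :: "bool \<Rightarrow> complex mat \<Rightarrow> complex mat" where
  "queried invq U = (if invq then mat_adjoint U else U)"

fun gate_mat :: "nat \<Rightarrow> nat \<Rightarrow> complex mat \<Rightarrow> gate \<Rightarrow> complex mat" where
  "gate_mat N w U (Free V) = V"
| "gate_mat N w U (Query invq None) = kron (queried invq U) (1\<^sub>m w)"
| "gate_mat N w U (Query invq (Some (a, b))) =
     kron (queried invq U) (kron (1\<^sub>m a) (kron (qubit_proj 1) (1\<^sub>m b))) +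
     kron (1\<^sub>m N) (kron (1\<^sub>m a) (kron (qubit_proj 0) (1\<^sub>m b)))"

definition final_state ::
    "nat \<Rightarrow> query_alg \<Rightarrow> complex mat \<Rightarrow> complex Matrix.vec \<Rightarrow> complex Matrix.vec" where
  "final_state N \<A> U \<psi> =
     fold (\<lambda>g \<phi>. gate_mat N (wdim \<A>) U g *\<^sub>v \<phi>) (gates \<A>)
       (kron_vec \<psi> (unit_vec (wdim \<A>) 0))"

definition output_prob ::
    "nat \<Rightarrow> query_alg \<Rightarrow> complex mat \<Rightarrow> complex Matrix.vec \<Rightarrow> real set \<Rightarrow> real" where
  "output_prob N \<A> U \<psi> S =
     (let \<phi> = final_state N \<A> U \<psi> in Re ((meas \<A> S *\<^sub>v \<phi>) \<bullet>c \<phi>))"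

section \<open>Phase estimation\<close>

text \<open>The quotient distance on \<open>\<real>/2\<pi>\<int>\<close>.\<close>

definition circle_dist :: "real \<Rightarrow> real \<Rightarrow> real" where
  "circle_dist x y = (INF k::int. \<bar>x - y + 2 * pi * of_int k\<bar>)"

definition solves_QPE :: "nat \<Rightarrow> real \<Rightarrow> real \<Rightarrow> query_alg \<Rightarrow> bool" where
  "solves_QPE N \<delta> \<epsilon> \<A> \<longleftrightarrow>
     (\<forall>U \<psi> \<theta>. unitary_mat N U \<and> \<psi> \<in> carrier_vec N \<and> \<psi> \<bullet>c \<psi> = 1 \<and>
        \<theta> \<in> {0..<2 * pi} \<and> U *\<^sub>v \<psi> = exp (\<i> * of_real \<theta>) \<cdot>\<^sub>v \<psi> \<longrightarrow>
        output_prob N \<A> U \<psi> {t \<in> {0..<2 * pi}. circle_dist t \<theta> \<le> \<delta>} \<ge> 1 - \<epsilon>)"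

end

theory Submission
  imports Defs "HOL-Complex_Analysis.Conformal_Mappings"
begin

text \<open>It suffices to look at the inputs \<open>U = e\<^bsup>i\<theta>\<^esup> I\<close> on one fixed state. After \<open>T\<close> queries the amplitudes
  are trigonometric polynomials in \<open>\<theta>\<close> of degree at most \<open>T\<close>, so the probability \<open>P\<^sub>S(\<theta>)\<close> of an
  outcome in \<open>S\<close> is a nonnegative trigonometric polynomial of degree at most \<open>n = 2T\<close>.

  For \<open>\<epsilon> \<le> 1/4\<close> take for \<open>S\<close> the arc of radius \<open>\<delta>\<close> around \<open>0\<close>: then \<open>P\<^sub>S(0) \<ge> 1 - \<epsilon>\<close>, while
  \<open>P\<^sub>S \<le> \<epsilon>\<close> outside the arc of radius \<open>2\<delta>\<close>. The even part of \<open>P\<^sub>S\<close> is a polynomial in \<open>cos \<theta>\<close>, and the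
  Bernstein--Walsh inequality gives \<open>1 - \<epsilon> \<le> \<epsilon> e\<^bsup>O(T\<delta>)\<^esup>\<close>.

  For \<open>\<epsilon>\<close> near \<open>1/2\<close> this is void, and one packs \<open>K \<approx> \<pi>/\<delta>\<close> disjoint arcs \<open>S\<^sub>j\<close> around angles
  \<open>\<alpha>\<^sub>j\<close>. The sum of a trigonometric polynomial of degree \<open>n\<close> over \<open>n + 1\<close> equispaced nodes does not
  depend on their offset, so \<open>P\<^sub>S(\<alpha>)\<close> is at most the sum of \<open>P\<^sub>S\<close> over fixed nodes; summing over the
  arcs yields \<open>K (1 - \<epsilon>) \<le> n + 1\<close>.\<close>

section \<open>Trigonometric polynomials\<close>

text \<open>Generated by single frequencies and sums, so that closure properties and linear
  identities need checking only on one exponential. Coefficients are complex, as amplitudes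
  are.\<close>

inductive trig_poly :: "nat \<Rightarrow> (real \<Rightarrow> complex) \<Rightarrow> bool" for n where
  basis: "\<bar>k\<bar> \<le> int n \<Longrightarrow> trig_poly n (\<lambda>\<theta>. c * cis (of_int k * \<theta>))"
| add: "trig_poly n f \<Longrightarrow> trig_poly n g \<Longrightarrow> trig_poly n (\<lambda>\<theta>. f \<theta> + g \<theta>)"

lemma trig_poly_const: "trig_poly n (\<lambda>_. c)"
  using trig_poly.basis[of 0 n c] by simp

lemma trig_poly_sum:
  "(\<And>i. i \<in> I \<Longrightarrow> trig_poly n (f i)) \<Longrightarrow> trig_poly n (\<lambda>\<theta>. \<Sum>i\<in>I. f i \<theta>)"
  by (induction I rule: infinite_finite_induct)
     (auto intro: trig_poly.add trig_poly_const)

lemma trig_poly_mult_basis: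
  assumes "trig_poly n f" "\<bar>k\<bar> \<le> int m"
  shows "trig_poly (n + m) (\<lambda>\<theta>. f \<theta> * (c * cis (of_int k * \<theta>)))"
  using assms(1)
proof induction
  case (basis l d)
  have "\<bar>l + k\<bar> \<le> int (n + m)" using basis assms(2) by simp
  from trig_poly.basis[OF this, of "d * c"] show ?case
    by (simp add: cis_mult[symmetric] algebra_simps)
next
  case (add f g)
  from trig_poly.add[OF add.IH] show ?case by (simp add: algebra_simps)
qed

lemma trig_poly_mult:
  assumes "trig_poly n f" "trig_poly m g"
  shows "trig_poly (n + m) (\<lambda>\<theta>. f \<theta> * g \<theta>)"
  using assms(2)
proof induction
  case (basis l d)
  then show ?case by (rule trig_poly_mult_basis[OF assms(1)])
next
  case (add f g)
  from trig_poly.add[OF add.IH] show ?case by (simp add: algebra_simps)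
qed

lemma trig_poly_cnj: "trig_poly n f \<Longrightarrow> trig_poly n (\<lambda>\<theta>. cnj (f \<theta>))"
proof (induction rule: trig_poly.induct)
  case (basis k c)
  then show ?case using trig_poly.basis[of "-k" n "cnj c"] by (simp add: cis_cnj)
next
  case (add f g)
  from trig_poly.add[OF add.IH] show ?case by simp
qed

section \<open>Even parts as polynomials in the cosine\<close>

text \<open>The witnesses are the Chebyshev polynomials of the first kind, built by the recurrence
  \<open>T (k + 2) = 2 x T (k + 1) - T k\<close>; only the degree bound is kept.\<close>

lemma cos_multiple_poly:
  "\<exists>p :: complex poly. degree p \<le> k \<and> (\<forall>\<theta>. complex_of_real (cos (real k * \<theta>)) = poly p (complex_of_real (cos \<theta>)))"
proof (induction k rule: less_induct)
  case (less k)
  consider "k = 0" | "k = 1" | j where "k = Suc (Suc j)"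
    by (metis One_nat_def not0_implies_Suc)
  then show ?case
  proof cases
    case 1
    then show ?thesis by (intro exI[of _ 1]) simp
  next
    case 2
    then show ?thesis by (intro exI[of _ "[:0, 1:]"]) simp
  next
    case 3
    obtain p where p: "degree p \<le> Suc j"
      "\<And>\<theta>. complex_of_real (cos (real (Suc j) * \<theta>)) = poly p (complex_of_real (cos \<theta>))"
      using less[of "Suc j"] 3 by (metis lessI)
    obtain q where q: "degree q \<le> j"
      "\<And>\<theta>. complex_of_real (cos (real j * \<theta>)) = poly q (complex_of_real (cos \<theta>))"
      using less[of j] 3 by (metis less_Suc_eq lessI)
    have deg: "degree (pCons 0 (Polynomial.smult 2 p) - q) \<le> k"
      using p(1) q(1) 3 degree_pCons_le[of 0 "Polynomial.smult 2 p"]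
      by (intro degree_diff_le) (auto intro: le_trans)
    have "complex_of_real (cos (real k * \<theta>)) = poly (pCons 0 (Polynomial.smult 2 p) - q) (complex_of_real (cos \<theta>))" for \<theta>
    proof -
      have "cos (real k * \<theta>) = 2 * cos \<theta> * cos (real (Suc j) * \<theta>) - cos (real j * \<theta>)"
        using cos_add[of "real (Suc j) * \<theta>" \<theta>] cos_diff[of "real (Suc j) * \<theta>" \<theta>] 3
        by (simp add: algebra_simps)
      then have "complex_of_real (cos (real k * \<theta>)) =
        2 * of_real (cos \<theta>) * of_real (cos (real (Suc j) * \<theta>)) - of_real (cos (real j * \<theta>))"
        by simp
      then show ?thesis unfolding p(2) q(2) by simp
    qed
    then show ?thesis using deg by blast
  qed
qed

text \<open>Symmetrizing turns the frequency k into \<open>2 * c * cos (k * \<theta>)\<close>, to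
  which the Chebyshev polynomial of index |k| applies.\<close>

lemma trig_poly_even_part:
  assumes "trig_poly n f"
  shows "\<exists>p. degree p \<le> n \<and> (\<forall>\<theta>. f \<theta> + f (- \<theta>) = poly p (complex_of_real (cos \<theta>)))"
  using assms
proof induction
  case (basis k c)
  obtain p where p: "degree p \<le> nat \<bar>k\<bar>"
      "\<And>\<theta>. complex_of_real (cos (real (nat \<bar>k\<bar>) * \<theta>)) = poly p (complex_of_real (cos \<theta>))"
    using cos_multiple_poly[of "nat \<bar>k\<bar>"] by blast
  have "c * cis (of_int k * \<theta>) + c * cis (of_int k * - \<theta>) = poly (Polynomial.smult (2 * c) p) (complex_of_real (cos \<theta>))" for \<theta>
    unfolding poly_smult p(2)[symmetric]
    by (cases "k \<ge> 0") (auto simp: complex_eq_iff algebra_simps)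
  moreover have "degree (Polynomial.smult (2 * c) p) \<le> n" 
    using p(1) basis degree_smult_le[of "2 * c" p] by linarith
  ultimately show ?case by blast
next
  case (add f g)
  from add.IH obtain p q where "degree p \<le> n" "\<forall>\<theta>. f \<theta> + f (- \<theta>) = poly p (complex_of_real (cos \<theta>))"
     "degree q \<le> n" "\<forall>\<theta>. g \<theta> + g (- \<theta>) = poly q (complex_of_real (cos \<theta>))"
    by blast
  then show ?case
    by (intro exI[of _ "p + q"]) (auto intro: degree_add_le simp: algebra_simps simp flip: add.assoc)
qed

section \<open>Sums over equispaced nodes\<close>

text \<open>The constant frequency ignores the offset. For any other k, 0 < |k| < m, so the nodes
  yield a geometric sum of an m-th root of unity different from 1, which vanishes for every
  offset.\<close>

lemma trig_poly_equispaced_sum: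
  assumes "trig_poly n f" "n < m"
  shows "(\<Sum>r<m. f (\<alpha> + 2 * pi * real r / real m)) = (\<Sum>r<m. f (\<beta> + 2 * pi * real r / real m))"
  using assms(1)
proof induction
  case (basis k c)
  show ?case
  proof (cases "k = 0")
    case False
    define \<omega> where "\<omega> = cis (2 * pi * of_int k / real m)"
    have "\<omega> \<noteq> 1"
    proof
      assume "\<omega> = 1"
      then obtain l :: int where "2 * pi * of_int k / real m = of_int (2 * l) * pi"
        unfolding \<omega>_def cis_conv_exp exp_eq_1 by auto
      then have "real_of_int k = of_int (l * int m)"
        using assms(2) by (simp add: field_simps)
      then have "k = l * int m" by linarith
      then have "\<bar>k\<bar> = \<bar>l\<bar> * int m" by (simp add: abs_mult)
      moreover have "\<bar>l\<bar> \<ge> 1" using False \<open>k = l * int m\<close> by auto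
      ultimately have "\<bar>k\<bar> \<ge> int m" by (metis mult_1 mult_right_mono of_nat_0_le_iff)
      then show False using basis assms(2) by linarith
    qed
    moreover have "\<omega> ^ m = 1"
    proof -
      have "real m * (2 * pi * of_int k / real m) = 2 * pi * of_int k"
        using assms(2) by simp
      then show ?thesis
        unfolding \<omega>_def Complex.DeMoivre by (simp only: cis_multiple_2pi[OF Ints_of_int])
    qed
    ultimately have 0: "(\<Sum>r<m. \<omega> ^ r) = 0" by (simp add: sum_gp_strict)
    have "(\<Sum>r<m. c * cis (of_int k * (\<gamma> + 2 * pi * real r / real m))) = 0" for \<gamma>
    proof -
      have "c * cis (of_int k * (\<gamma> + 2 * pi * real r / real m)) = c * cis (of_int k * \<gamma>) * \<omega> ^ r" for r
        unfolding \<omega>_def Complex.DeMoivre by (simp add: cis_mult algebra_simps)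
      then show ?thesis by (simp only: 0 mult_zero_right flip: sum_distrib_left)
    qed
    then show ?thesis by simp
  qed simp
next
  case (add f g)
  then show ?case by (simp add: sum.distrib)
qed

section \<open>Growth of polynomials beyond an interval\<close>

text \<open>The maximum principle is applied to \<open>w\<^sup>n p((w + 1/w)/2)\<close> on the unit disc; on the
  unit circle the argument of \<open>p\<close> is \<open>Re w\<close>.\<close>

lemma bernstein_walsh:
  fixes p :: "complex poly"
  assumes deg: "degree p \<le> n"
    and bnd: "\<And>x::real. \<lbrakk>-1 \<le> x; x \<le> 1\<rbrakk> \<Longrightarrow> norm (poly p (of_real x)) \<le> M"
    and s: "0 \<le> s"
  shows "norm (poly p (of_real (cosh s))) \<le> M * exp (real n * s)"
proof -
  \<comment> \<open>Multiplying by \<open>w ^ n\<close> clears the pole at 0. Writing the result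
    through coefficients makes it visibly a polynomial in w, hence holomorphic on the whole
    disc.\<close>
  define f where "f = (\<lambda>w::complex. \<Sum>i\<le>n. coeff p i * ((w\<^sup>2 + 1) / 2) ^ i * w ^ (n - i))"
  have f: "f w = w ^ n * poly p ((w + 1 / w) / 2)" if "w \<noteq> 0" for w
  proof -
    have "poly p x = (\<Sum>i\<le>n. coeff p i * x ^ i)" for x
      unfolding poly_altdef using deg
      by (intro sum.mono_neutral_left) (auto simp: coeff_eq_0)
    moreover have "((w\<^sup>2 + 1) / 2) ^ i * w ^ (n - i) = w ^ n * ((w + 1 / w) / 2) ^ i" if "i \<le> n" for i
    proof -
      have "(w\<^sup>2 + 1) / 2 = w * ((w + 1 / w) / 2)"
        using \<open>w \<noteq> 0\<close> by (simp add: field_simps power2_eq_square)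
      moreover have "w ^ n = w ^ i * w ^ (n - i)" using that by (simp flip: power_add)
      ultimately show ?thesis by (simp only: power_mult_distrib) (simp add: ac_simps)
    qed
    ultimately show ?thesis
      unfolding f_def by (simp add: sum_distrib_left mult.assoc mult.left_commute)
  qed
  \<comment> \<open>The point \<open>w = exp (- s)\<close> lies in the disc because s is
    nonnegative, and there \<open>(w + 1 / w) / 2\<close> is \<open>cosh s\<close>.\<close>
  have "norm (f (of_real (exp (- s)))) \<le> M"
  proof (rule maximum_modulus_frontier[of f "cball 0 1"])
    show "f holomorphic_on interior (cball 0 1)"
      unfolding f_def by (intro holomorphic_intros) auto
    show "continuous_on (closure (cball 0 1)) f"
      unfolding f_def by (intro continuous_intros) auto
    fix z :: complex assume "z \<in> frontier (cball 0 1)"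
    then have z: "norm z = 1" by simp
    then have "z \<noteq> 0" by auto
    have "z * cnj z = 1" using z by (simp flip: complex_norm_square)
    then have "1 / z = cnj z" using \<open>z \<noteq> 0\<close> by (simp add: field_simps)
    then have "(z + 1 / z) / 2 = of_real (Re z)" by (simp add: complex_add_cnj)
    moreover have "\<bar>Re z\<bar> \<le> 1" using abs_Re_le_cmod[of z] z by simp
    ultimately show "norm (f z) \<le> M"
      using f[OF \<open>z \<noteq> 0\<close>] z bnd[of "Re z"] by (auto simp: norm_mult norm_power)
  qed (use s in auto)
  moreover have "(of_real (exp (- s)) + 1 / of_real (exp (- s))) / 2 = complex_of_real (cosh s)"
    by (simp add: cosh_field_def exp_minus field_simps)
  ultimately have "norm (of_real (exp (- s)) ^ n * poly p (complex_of_real (cosh s))) \<le> M"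
    using f[of "of_real (exp (- s))"] by simp
  then have "exp (- s) ^ n * norm (poly p (complex_of_real (cosh s))) \<le> M"
    by (simp add: norm_mult norm_power)
  then show ?thesis
    by (simp add: exp_minus field_simps exp_of_nat2_mult)
qed

text \<open>The affine map \<open>x \<mapsto> ((1 + c) * x - (1 - c)) / 2\<close> carries [-1, 1]
  onto [-1, c] and \<open>cosh s\<close> to y, and composing with it keeps the degree bound.\<close>

lemma bernstein_walsh_Icc:
  fixes p :: "complex poly"
  assumes deg: "degree p \<le> n"
    and bnd: "\<And>x::real. \<lbrakk>-1 \<le> x; x \<le> c\<rbrakk> \<Longrightarrow> norm (poly p (of_real x)) \<le> M"
    and s: "0 \<le> s" and c: "-1 < c"
    and y: "y = ((1 + c) * cosh s - (1 - c)) / 2"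
  shows "norm (poly p (of_real y)) \<le> M * exp (real n * s)"
proof -
  define q where "q = pcompose p [:of_real (- (1 - c) / 2), of_real ((1 + c) / 2):]"
  have q: "poly q (of_real x) = poly p (of_real (((1 + c) * x - (1 - c)) / 2))" for x
    unfolding q_def poly_pcompose by (rule arg_cong[of _ _ "poly p"]) (simp add: field_simps)
  have "degree q \<le> n"
  proof -
    have "degree q \<le> degree p * 1" unfolding q_def
      by (rule le_trans[OF degree_pcompose_le mult_le_mono2]) simp
    then show ?thesis using deg by simp
  qed
  moreover have "norm (poly q (of_real x)) \<le> M" if "-1 \<le> x" "x \<le> 1" for x
    unfolding q
  proof (rule bnd)
    have "(1 + c) * x \<le> (1 + c) * 1" "(1 + c) * (-1) \<le> (1 + c) * x"
      using that c by (intro mult_left_mono; simp)+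
    then show "-1 \<le> ((1 + c) * x - (1 - c)) / 2" "((1 + c) * x - (1 - c)) / 2 \<le> c"
      by simp_all
  qed
  ultimately have "norm (poly q (of_real (cosh s))) \<le> M * exp (real n * s)"
    using s by (rule bernstein_walsh)
  then show ?thesis unfolding q y .
qed

lemma le_sinh: "x \<le> sinh x" if "0 \<le> (x::real)"
proof -
  have "(\<lambda>x. sinh x - x) 0 \<le> (\<lambda>x. sinh x - x) x"
    by (rule DERIV_nonneg_imp_nondecreasing[OF that])
       (auto intro!: exI derivative_eq_intros simp: cosh_real_ge_1)
  then show ?thesis by simp
qed

lemma arsinh_le: "arsinh x \<le> x" if "0 \<le> (x::real)"
  using le_sinh[OF that] by (metis arsinh_sinh_real arsinh_less_iff_real linorder_not_le)

text \<open>The even part of P is a polynomial in the cosine, at most \<open>2 * \<epsilon>\<close>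
  on \<open>[-1, cos (2 * e)]\<close>. Growth from there to 1, the cosine of 0, costs at most a
  factor \<open>exp (n * s)\<close> with s linear in e.\<close>

lemma trig_poly_concentration:
  fixes P :: "real \<Rightarrow> real"
  assumes tp: "trig_poly n (\<lambda>\<theta>. complex_of_real (P \<theta>))"
    and nonneg: "\<And>\<theta>. 0 \<le> P \<theta>" and e: "0 < e" "e < pi / 3"
    and small: "\<And>\<theta>. cos \<theta> \<le> cos (2 * e) \<Longrightarrow> P \<theta> \<le> \<epsilon>"
  shows "P 0 \<le> \<epsilon> * exp (real n * (4 * e))"
proof -
  obtain p where p: "degree p \<le> n"
    "\<And>\<theta>. complex_of_real (P \<theta>) + complex_of_real (P (- \<theta>)) = poly p (complex_of_real (cos \<theta>))"
    using trig_poly_even_part[OF tp] by auto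
  define c where "c = cos (2 * e)"
  \<comment> \<open>Chosen so that the affine image of \<open>cosh s\<close> is exactly 1: with
    \<open>1 + c = 2 * (cos e)\<^sup>2\<close> and \<open>1 - c = 2 * (sin e)\<^sup>2\<close> this
    asks for \<open>cosh s = 1 + 2 * (tan e)\<^sup>2\<close>.\<close>
  define s where "s = 2 * arsinh (tan e)"
  \<comment> \<open>This is where e < pi/3 enters: it gives \<open>tan e \<le> 2 * e\<close>, and
    hence \<open>s \<le> 4 * e\<close>.\<close>
  have cos_e: "1 / 2 < cos e"
    using cos_monotone_0_pi[of e "pi / 3"] e pi_gt_zero by (simp add: cos_60)
  have sin_e: "0 < sin e" "sin e \<le> e"
    using e sin_gt_zero[of e] by (auto intro: sin_x_le_x)
  have \<epsilon>: "0 \<le> \<epsilon>" using small[of "2 * e"] nonneg[of "2 * e"] by simp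
  have tan_e: "0 \<le> tan e" "tan e \<le> 2 * e"
  proof -
    have "sin e \<le> 2 * e * cos e"
      using mult_mono[of 1 "2 * cos e" "sin e" e] cos_e sin_e e by (simp add: ac_simps)
    then show "0 \<le> tan e" "tan e \<le> 2 * e"
      using cos_e sin_e by (simp_all add: tan_def field_simps)
  qed
  have s: "0 \<le> s" "s \<le> 4 * e"
    using arsinh_le[of "tan e"] tan_e unfolding s_def
    by (auto simp flip: linorder_not_less)
  have c: "1 + c = 2 * (cos e)\<^sup>2" "1 - c = 2 * (sin e)\<^sup>2"
    unfolding c_def by (simp add: cos_double_cos) (simp add: cos_double_sin)
  have cosh_s: "cosh s = 1 + 2 * (tan e)\<^sup>2"
    unfolding s_def cosh_double by (simp add: cosh_square_eq)
  have "((1 + c) * cosh s - (1 - c)) / 2 = (cos e)\<^sup>2 + 2 * ((cos e)\<^sup>2 * (tan e)\<^sup>2) - (sin e)\<^sup>2"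
    unfolding c cosh_s by (simp add: field_simps)
  also have "(cos e)\<^sup>2 * (tan e)\<^sup>2 = (sin e)\<^sup>2"
    using cos_e by (simp add: tan_def field_simps)
  finally have y: "1 = ((1 + c) * cosh s - (1 - c)) / 2"
    using sin_cos_squared_add[of e] by simp
  have "norm (poly p (complex_of_real 1)) \<le> (2 * \<epsilon>) * exp (real n * s)"
  proof (rule bernstein_walsh_Icc[OF p(1) _ s(1) _ y])
    show "-1 < c" using c(1) zero_less_power[of "cos e" 2] cos_e by linarith
    \<comment> \<open>Both \<open>arccos x\<close> and its negative have cosine x, so each of the
      two terms of the even part is at most \<epsilon>.\<close>
    fix x :: real assume x: "-1 \<le> x" "x \<le> c"
    then have "cos (arccos x) = x" unfolding c_def by (meson cos_arccos cos_le_one order_trans)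
    moreover have "P (arccos x) \<le> \<epsilon>" "P (- arccos x) \<le> \<epsilon>"
      using x small calculation by (auto simp: c_def)
    ultimately show "norm (poly p (complex_of_real x)) \<le> 2 * \<epsilon>"
      using p(2)[of "arccos x", symmetric] nonneg[of "arccos x"] nonneg[of "- arccos x"]
      by (simp flip: of_real_add)
  qed
  moreover have "poly p (complex_of_real 1) = complex_of_real (2 * P 0)"
    using p(2)[of 0] by simp
  ultimately have "2 * P 0 \<le> (2 * \<epsilon>) * exp (real n * s)"
    using nonneg[of 0] by simp
  also have "\<dots> \<le> (2 * \<epsilon>) * exp (real n * (4 * e))"
    using s \<epsilon> by (intro mult_left_mono) (auto intro: mult_left_mono)
  finally show ?thesis by simp
qed

text \<open>Nonnegativity bounds each value by a sum over n + 1 nodes starting at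
  \<open>\<alpha> j\<close>. Removing the offset makes the nodes the same for all j, so
  \<open>sum_le\<close> can be applied node by node.\<close>

lemma trig_poly_packing:
  fixes P :: "nat \<Rightarrow> real \<Rightarrow> real"
  assumes tp: "\<And>j. j < K \<Longrightarrow> trig_poly n (\<lambda>\<theta>. complex_of_real (P j \<theta>))"
    and nonneg: "\<And>j \<theta>. j < K \<Longrightarrow> 0 \<le> P j \<theta>"
    and sum_le: "\<And>\<theta>. (\<Sum>j<K. P j \<theta>) \<le> 1"
  shows "(\<Sum>j<K. P j (\<alpha> j)) \<le> real n + 1"
proof -
  define \<beta> where "\<beta> r = 2 * pi * real r / real (Suc n)" for r
  have "P j (\<alpha> j) \<le> (\<Sum>r<Suc n. P j (\<beta> r))" if j: "j < K" for j
  proof -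
    have "complex_of_real (\<Sum>r<Suc n. P j (\<alpha> j + \<beta> r)) = of_real (\<Sum>r<Suc n. P j (0 + \<beta> r))"
      using trig_poly_equispaced_sum[OF tp[OF j], of "Suc n" "\<alpha> j" 0]
      unfolding \<beta>_def of_real_sum by simp
    then have "(\<Sum>r<Suc n. P j (\<alpha> j + \<beta> r)) = (\<Sum>r<Suc n. P j (\<beta> r))"
      unfolding of_real_eq_iff by simp
    moreover have "P j (\<alpha> j + \<beta> 0) \<le> (\<Sum>r<Suc n. P j (\<alpha> j + \<beta> r))"
      using nonneg[OF j] by (intro member_le_sum) auto
    ultimately show ?thesis by (simp add: \<beta>_def)
  qed
  then have "(\<Sum>j<K. P j (\<alpha> j)) \<le> (\<Sum>j<K. \<Sum>r<Suc n. P j (\<beta> r))"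
    by (intro sum_mono) auto
  also have "\<dots> = (\<Sum>r<Suc n. \<Sum>j<K. P j (\<beta> r))"
    by (rule sum.swap)
  also have "\<dots> \<le> (\<Sum>r<Suc n. 1)"
    by (intro sum_mono sum_le)
  finally show ?thesis by simp
qed

section \<open>Query algorithms on scalar inputs\<close>

text \<open>On scalar inputs every factor of a query is diagonal, so this is the only Kronecker
  product that has to be computed.\<close>

lemma kron_mat_diag:
  "kron (mat_diag m f) (mat_diag n g) = mat_diag (m * n) (\<lambda>i. f (i div n) * g (i mod n))"
proof (rule eq_matI)
  fix i j assume "i < dim_row (mat_diag (m * n) (\<lambda>i. f (i div n) * g (i mod n)))"
    "j < dim_col (mat_diag (m * n) (\<lambda>i. f (i div n) * g (i mod n)))"
  then have ij: "i < m * n" "j < m * n" by (auto simp: mat_diag_def)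
  then have "n > 0" by (cases n) auto
  with ij have "i div n < m" "j div n < m" "i mod n < n" "j mod n < n"
    by (auto simp: less_mult_imp_div_less)
  moreover have "i = j \<longleftrightarrow> i div n = j div n \<and> i mod n = j mod n"
    by (metis div_mult_mod_eq)
  ultimately show "kron (mat_diag m f) (mat_diag n g) $$ (i, j) =
      mat_diag (m * n) (\<lambda>i. f (i div n) * g (i mod n)) $$ (i, j)"
    using ij by (auto simp: kron_def mat_diag_def)
qed (auto simp: kron_def mat_diag_def)

lemma qubit_proj_eq_diag: "qubit_proj b = mat_diag 2 (\<lambda>i. if i = b then 1 else 0)"
  by (auto simp: mat_diag_def qubit_proj_def)

definition scalar_unitary :: "nat \<Rightarrow> real \<Rightarrow> complex mat" where
  "scalar_unitary N \<theta> = mat_diag N (\<lambda>_. cis \<theta>)"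

lemma mat_adjoint_index:
  fixes A :: "complex mat"
  assumes "i < dim_col A" "j < dim_row A"
  shows "mat_adjoint A $$ (i, j) = cnj (A $$ (j, i))"
  using assms unfolding mat_adjoint_def by (simp add: mat_of_rows_index)

lemma mat_adjoint_dim [simp]:
  "dim_row (mat_adjoint A) = dim_col A" "dim_col (mat_adjoint A) = dim_row A"
  unfolding mat_adjoint_def by auto

lemma queried_scalar_unitary:
  "queried invq (scalar_unitary N \<theta>) = mat_diag N (\<lambda>_. cis (if invq then - \<theta> else \<theta>))"
proof (cases invq)
  case True
  have "mat_adjoint (scalar_unitary N \<theta>) = mat_diag N (\<lambda>_. cis (- \<theta>))"
    by (rule eq_matI) (auto simp: mat_adjoint_index scalar_unitary_def mat_diag_def cis_cnj)
  then show ?thesis using True by (simp add: queried_def)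
qed (simp add: queried_def scalar_unitary_def)

lemma unitary_scalar_unitary: "unitary_mat N (scalar_unitary N \<theta>)"
proof -
  have "mat_adjoint (scalar_unitary N \<theta>) = mat_diag N (\<lambda>_. cis (- \<theta>))"
    using queried_scalar_unitary[of True N \<theta>] by (simp add: queried_def)
  then show ?thesis
    unfolding unitary_mat_def by (simp add: scalar_unitary_def cis_mult)
qed

lemma scalar_unitary_mult_vec:
  "v \<in> carrier_vec N \<Longrightarrow> scalar_unitary N \<theta> *\<^sub>v v = exp (\<i> * of_real \<theta>) \<cdot>\<^sub>v v"
  by (intro eq_vecI)
     (auto simp: scalar_unitary_def mat_diag_def scalar_prod_def cis_conv_exp if_distrib[of "\<lambda>x. x * _"]
        sum.delta cong: if_cong)

text \<open>The predicate \<beta> marks the basis states on which the query fires: all of them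
  without control, those with control bit 1 otherwise. It is chosen before \<theta>, so only the
  phase depends on \<theta>.\<close>

lemma gate_mat_query_diag:
  assumes "valid_gate N w (Query invq ctrl)"
  shows "\<exists>\<beta>. \<forall>\<theta>. gate_mat N w (scalar_unitary N \<theta>) (Query invq ctrl) =
     mat_diag (N * w) (\<lambda>i. if \<beta> i then cis (if invq then - \<theta> else \<theta>) else 1)"
proof (cases ctrl)
  case None
  then show ?thesis
    by (intro exI[of _ "\<lambda>_. True"]) (simp add: queried_scalar_unitary kron_mat_diag flip: mat_diag_one)
next
  case (Some ab)
  obtain a b where ab: "ab = (a, b)" by force
  have w: "w = a * (2 * b)" using assms Some ab by simp
  \<comment> \<open>The control digit of i: discard the first register, then the factor of dimension
    a, then the factor of dimension b.\<close>
  define bit where "bit i = (i mod w mod (2 * b)) div b" for i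
  have bit: "bit i = 0 \<or> bit i = 1" if "i < N * w" for i
  proof -
    \<comment> \<open>A valid controlled gate may have b = 0 when w = 0; the existence of an index
      below \<open>N * w\<close> excludes this.\<close>
    have "b > 0" using that w by (cases b) auto
    then have "bit i < 2" unfolding bit_def by (simp add: less_mult_imp_div_less)
    then show ?thesis by auto
  qed
  show ?thesis unfolding Some ab
  proof (intro exI[of _ "\<lambda>i. bit i = 1"] allI)
    fix \<theta>
    show "gate_mat N w (scalar_unitary N \<theta>) (Query invq (Some (a, b))) =
     mat_diag (N * w) (\<lambda>i. if bit i = 1 then cis (if invq then - \<theta> else \<theta>) else 1)"
      unfolding gate_mat.simps queried_scalar_unitary mat_diag_one[symmetric] qubit_proj_eq_diag
        kron_mat_diag w[symmetric] bit_def[symmetric]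
      by (rule eq_matI) (use bit in \<open>fastforce simp: mat_diag_def\<close>)+
  qed
qed

section \<open>Inner products and preservation of norms\<close>

lemma cscalar_prod_sum:
  fixes u v :: "complex Matrix.vec"
  shows "u \<bullet>c v = (\<Sum>i<dim_vec v. vec_index u i * cnj (vec_index v i))"
  by (auto simp: scalar_prod_def lessThan_atLeast0)

lemma mult_mat_vec_index_sum:
  assumes "dim_vec v = dim_col A" "i < dim_row A"
  shows "vec_index (A *\<^sub>v v) i = (\<Sum>j<dim_vec v. A $$ (i, j) * vec_index v j)"
  using assms by (auto simp: scalar_prod_def lessThan_atLeast0)

lemma cscalar_prod_mult_mat_vec:
  fixes A :: "complex mat"
  assumes "A \<in> carrier_mat n n" "u \<in> carrier_vec n" "v \<in> carrier_vec n"
  shows "u \<bullet>c (A *\<^sub>v v) = (mat_adjoint A *\<^sub>v u) \<bullet>c v"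
proof -
  have d: "dim_vec u = n" "dim_vec v = n" "dim_row A = n" "dim_col A = n"
    using assms by auto
  have "u \<bullet>c (A *\<^sub>v v) = (\<Sum>i<n. vec_index u i * cnj (\<Sum>j<n. A $$ (i, j) * vec_index v j))"
    unfolding cscalar_prod_sum by (intro sum.cong) (auto simp: d mult_mat_vec_index_sum simp del: index_mult_mat_vec)
  also have "\<dots> = (\<Sum>j<n. (\<Sum>i<n. cnj (A $$ (i, j)) * vec_index u i) * cnj (vec_index v j))"
    unfolding cnj_sum sum_distrib_left sum_distrib_right
    by (subst sum.swap) (simp add: ac_simps)
  also have "\<dots> = (mat_adjoint A *\<^sub>v u) \<bullet>c v"
    unfolding cscalar_prod_sum
    by (intro sum.cong) (auto simp: d mult_mat_vec_index_sum mat_adjoint_index simp del: index_mult_mat_vec)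
  finally show ?thesis .
qed

lemma unitary_mat_norm:
  assumes "unitary_mat n A" "v \<in> carrier_vec n"
  shows "(A *\<^sub>v v) \<bullet>c (A *\<^sub>v v) = v \<bullet>c v"
proof -
  have A: "A \<in> carrier_mat n n" "mat_adjoint A * A = 1\<^sub>m n"
    using assms(1) by (auto simp: unitary_mat_def)
  from A(1) have adj: "mat_adjoint A \<in> carrier_mat n n" by (intro carrier_matI) auto
  have "mat_adjoint A *\<^sub>v (A *\<^sub>v v) = v"
    unfolding assoc_mult_mat_vec[OF adj A(1) assms(2), symmetric] A(2)
    using assms(2) by (rule one_mult_mat_vec)
  then show ?thesis
    using cscalar_prod_mult_mat_vec[OF A(1) mult_mat_vec_carrier[OF A(1) assms(2)] assms(2)]
    by (simp only:)
qed

lemma mat_diag_mult_vec_index: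
  assumes "v \<in> carrier_vec n" "i < n"
  shows "vec_index (mat_diag n f *\<^sub>v v) i = f i * vec_index v i"
  using assms
  by (auto simp: mat_diag_def scalar_prod_def if_distrib[of "\<lambda>x. x * _"] sum.delta cong: if_cong)

lemma mat_diag_unimodular_norm:
  assumes v: "v \<in> carrier_vec n" and f: "\<And>i. i < n \<Longrightarrow> norm (f i :: complex) = 1"
  shows "(mat_diag n f *\<^sub>v v) \<bullet>c (mat_diag n f *\<^sub>v v) = v \<bullet>c v"
proof -
  have "f i * x * cnj (f i * x) = x * cnj x" if "i < n" for i x
    using f[OF that] by (simp only: complex_norm_square[symmetric] norm_mult) simp
  then show ?thesis
    unfolding cscalar_prod_sum using v
    by (intro sum.cong)
       (auto simp: mat_diag_mult_vec_index carrier_matD(1)[OF mat_diag_dim] simp del: index_mult_mat_vec)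
qed

text \<open>A free gate mixes amplitudes with coefficients independent of \<theta>, which keeps the
  degree. A query multiplies each amplitude by 1 or by one exponential of frequency 1 or -1, which
  raises it by at most one. Both preserve the norm.\<close>

lemma run_gates:
  assumes "\<forall>g\<in>set gs. valid_gate N w g" and v: "v \<in> carrier_vec (N * w)"
  defines "run \<equiv> \<lambda>\<theta>. fold (\<lambda>g \<phi>. gate_mat N w (scalar_unitary N \<theta>) g *\<^sub>v \<phi>) gs v"
  shows "(\<forall>\<theta>. run \<theta> \<in> carrier_vec (N * w) \<and> run \<theta> \<bullet>c run \<theta> = v \<bullet>c v) \<and>
    (\<forall>i<N * w. trig_poly (length (filter is_query gs)) (\<lambda>\<theta>. vec_index (run \<theta>) i))"
  using assms(1) unfolding run_def
\<comment> \<open>Splitting off the gate applied last keeps the initial vector v fixed in the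
  induction.\<close>
proof (induction gs rule: rev_induct)
  case Nil
  then show ?case using v by (auto intro: trig_poly_const)
next
  case (snoc g gs)
  define r where "r \<theta> = fold (\<lambda>g \<phi>. gate_mat N w (scalar_unitary N \<theta>) g *\<^sub>v \<phi>) gs v" for \<theta>
  define T where "T = length (filter is_query gs)"
  have r: "r \<theta> \<in> carrier_vec (N * w)" "r \<theta> \<bullet>c r \<theta> = v \<bullet>c v" for \<theta>
    using snoc unfolding r_def by auto
  have tp: "trig_poly T (\<lambda>\<theta>. vec_index (r \<theta>) i)" if "i < N * w" for i
    using snoc that unfolding r_def T_def by auto
  have valid: "valid_gate N w g" using snoc.prems by simp
  show ?case
  proof (cases g)
    case (Free V)
    have V: "V \<in> carrier_mat (N * w) (N * w)" and uV: "unitary_mat (N * w) V"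
      using valid Free by (auto simp: unitary_mat_def)
    have "trig_poly T (\<lambda>\<theta>. vec_index (V *\<^sub>v r \<theta>) i)" if "i < N * w" for i
    proof -
      have "(\<lambda>\<theta>. vec_index (V *\<^sub>v r \<theta>) i) = (\<lambda>\<theta>. \<Sum>j<N * w. V $$ (i, j) * vec_index (r \<theta>) j)"
        using V that
        by (simp add: mult_mat_vec_index_sum carrier_vecD[OF r(1)] fun_eq_iff del: index_mult_mat_vec)
      moreover have "trig_poly T (\<lambda>\<theta>. \<Sum>j<N * w. V $$ (i, j) * vec_index (r \<theta>) j)"
        \<comment> \<open>The matrix entry is taken as a trigonometric polynomial of degree 0, so
          the product stays at degree T.\<close>
        using trig_poly_mult[OF trig_poly_const[of 0] tp]
        by (intro trig_poly_sum) simp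
      ultimately show ?thesis by simp
    qed
    then show ?thesis
      using Free V r unitary_mat_norm[OF uV r(1)] by (auto simp: r_def T_def simp del: index_mult_mat_vec)
  next
    case (Query invq ctrl)
    obtain \<beta> where \<beta>: "gate_mat N w (scalar_unitary N \<theta>) g =
       mat_diag (N * w) (\<lambda>i. if \<beta> i then cis (if invq then - \<theta> else \<theta>) else 1)" for \<theta>
      using gate_mat_query_diag valid unfolding Query by blast
    have "trig_poly (Suc T) (\<lambda>\<theta>. (if \<beta> i then cis (if invq then - \<theta> else \<theta>) else 1) * vec_index (r \<theta>) i)"
      if "i < N * w" for i
    proof -
      have "trig_poly 1 (\<lambda>\<theta>. if \<beta> i then cis (if invq then - \<theta> else \<theta>) else 1)"
        using trig_poly.basis[of "if invq then - 1 else 1" 1 1] trig_poly_const[of 1 1]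
        by (cases "\<beta> i"; cases invq) auto
      from trig_poly_mult[OF this tp[OF that]] show ?thesis by simp
    qed
    then have "\<forall>i<N * w. trig_poly (Suc T) (\<lambda>\<theta>. vec_index (gate_mat N w (scalar_unitary N \<theta>) g *\<^sub>v r \<theta>) i)"
      unfolding \<beta> using r(1) by (simp add: mat_diag_mult_vec_index del: index_mult_mat_vec)
    moreover have "(gate_mat N w (scalar_unitary N \<theta>) g *\<^sub>v r \<theta>) \<bullet>c (gate_mat N w (scalar_unitary N \<theta>) g *\<^sub>v r \<theta>) = v \<bullet>c v" for \<theta>
      unfolding \<beta> using r by (subst mat_diag_unimodular_norm) auto
    moreover have "gate_mat N w (scalar_unitary N \<theta>) g *\<^sub>v r \<theta> \<in> carrier_vec (N * w)" for \<theta>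
      unfolding \<beta> using mult_mat_vec_carrier[OF mat_diag_dim r(1)] .
    ultimately show ?thesis using Query by (simp add: r_def T_def)
  qed
qed

section \<open>Additivity of outcome probabilities\<close>

text \<open>Apply countable additivity to the constantly empty family: a constant series converges
  only if its term is zero.\<close>

lemma povm_empty:
  fixes M :: "'a measure"
  assumes "povm M n E" "i < n" "j < n"
  shows "E {} $$ (i, j) = 0"
proof -
  have "range (\<lambda>_::nat. {}) \<subseteq> sets M \<and> disjoint_family (\<lambda>_::nat. {} :: 'a set)"
    by (auto simp: disjoint_family_on_def)
  then have "(\<lambda>_::nat. E {} $$ (i, j)) sums (E (\<Union>k::nat. {}) $$ (i, j))"
    using assms unfolding povm_def by blast
  then show ?thesis by (auto dest!: sums_summable simp: summable_const_iff)
qed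

lemma povm_finite_additive:
  fixes A :: "nat \<Rightarrow> 'a set"
  assumes E: "povm M n E" and A: "\<And>k. k < K \<Longrightarrow> A k \<in> sets M" "disjoint_family_on A {..<K}"
    and ij: "i < n" "j < n"
  shows "E (\<Union>k<K. A k) $$ (i, j) = (\<Sum>k<K. E (A k) $$ (i, j))"
proof -
  define B where "B k = (if k < K then A k else {})" for k
  have "range B \<subseteq> sets M" "disjoint_family B"
    using A by (auto simp: B_def disjoint_family_on_def)
  moreover have "(\<Union>k. B k) = (\<Union>k<K. A k)" by (auto simp: B_def)
  ultimately have "(\<lambda>k. E (B k) $$ (i, j)) sums (E (\<Union>k<K. A k) $$ (i, j))"
    using E ij unfolding povm_def by metis
  moreover have "(\<lambda>k. E (B k) $$ (i, j)) sums (\<Sum>k<K. E (B k) $$ (i, j))"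
    by (rule sums_finite) (auto simp: B_def povm_empty[OF E ij])
  ultimately have "E (\<Union>k<K. A k) $$ (i, j) = (\<Sum>k<K. E (B k) $$ (i, j))"
    by (rule sums_unique2)
  then show ?thesis by (simp add: B_def)
qed

lemma quadratic_form_sum:
  fixes A :: "complex mat"
  assumes "A \<in> carrier_mat n n" "v \<in> carrier_vec n"
  shows "(A *\<^sub>v v) \<bullet>c v = (\<Sum>i<n. \<Sum>j<n. A $$ (i, j) * vec_index v j * cnj (vec_index v i))"
  unfolding cscalar_prod_sum using assms
  by (intro sum.cong) (auto simp: mult_mat_vec_index_sum sum_distrib_right simp del: index_mult_mat_vec)

text \<open>Additivity is known entry by entry; expanding the quadratic form and exchanging sums
  transfers it to probabilities.\<close>

lemma povm_prob_additive:
  fixes A :: "nat \<Rightarrow> 'a set"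
  assumes E: "povm M n E" and A: "\<And>k. k < K \<Longrightarrow> A k \<in> sets M" "disjoint_family_on A {..<K}"
    and v: "v \<in> carrier_vec n"
  shows "(E (\<Union>k<K. A k) *\<^sub>v v) \<bullet>c v = (\<Sum>k<K. (E (A k) *\<^sub>v v) \<bullet>c v)"
proof -
  have car: "E S \<in> carrier_mat n n" if "S \<in> sets M" for S
    using E that by (auto simp: povm_def positive_op_def)
  have U: "(\<Union>k<K. A k) \<in> sets M" using A(1) by auto
  have "(\<Sum>k<K. (E (A k) *\<^sub>v v) \<bullet>c v) =
     (\<Sum>k<K. \<Sum>i<n. \<Sum>j<n. E (A k) $$ (i, j) * vec_index v j * cnj (vec_index v i))"
    by (intro sum.cong) (auto simp: quadratic_form_sum[OF car[OF A(1)] v])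
  also have "\<dots> = (\<Sum>i<n. \<Sum>k<K. \<Sum>j<n. E (A k) $$ (i, j) * vec_index v j * cnj (vec_index v i))"
    by (rule sum.swap)
  also have "\<dots> = (\<Sum>i<n. \<Sum>j<n. \<Sum>k<K. E (A k) $$ (i, j) * vec_index v j * cnj (vec_index v i))"
    by (intro sum.cong refl sum.swap)
  also have "\<dots> = (\<Sum>i<n. \<Sum>j<n. E (\<Union>k<K. A k) $$ (i, j) * vec_index v j * cnj (vec_index v i))"
    by (intro sum.cong refl) (simp add: povm_finite_additive[OF E A] sum_distrib_right)
  also have "\<dots> = (E (\<Union>k<K. A k) *\<^sub>v v) \<bullet>c v"
    by (rule quadratic_form_sum[OF car[OF U] v, symmetric])
  finally show ?thesis ..
qed

lemma povm_prob_sum_le: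
  fixes A :: "nat \<Rightarrow> 'a set"
  assumes E: "povm M n E" and A: "\<And>k. k < K \<Longrightarrow> A k \<in> sets M" "disjoint_family_on A {..<K}"
    and v: "v \<in> carrier_vec n" "v \<bullet>c v = 1"
  shows "(\<Sum>k<K. Re ((E (A k) *\<^sub>v v) \<bullet>c v)) \<le> 1"
proof -
  \<comment> \<open>Adding the complement as outcome number K gives a partition of the space, of
    total probability 1; that last term is then dropped, being nonnegative.\<close>
  define B where "B k = (if k < K then A k else space M - (\<Union>k<K. A k))" for k
  have "(\<Union>k<K. A k) \<in> sets M" using A(1) by auto
  then have B: "B k \<in> sets M" for k using A(1) by (auto simp: B_def)
  have dis: "disjoint_family_on B {..<Suc K}"
    using A(2) by (auto simp: B_def disjoint_family_on_def)
  have "(\<Union>k<K. A k) \<subseteq> space M" using A(1) sets.sets_into_space by blast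
  then have "(\<Union>k<Suc K. B k) = space M"
    by (auto simp: B_def less_Suc_eq lessThan_Suc)
  then have "(\<Sum>k<Suc K. (E (B k) *\<^sub>v v) \<bullet>c v) = (E (space M) *\<^sub>v v) \<bullet>c v"
    using povm_prob_additive[OF E B dis v(1)] by simp
  also have "\<dots> = 1" using E v by (simp add: povm_def)
  finally have "(\<Sum>k<Suc K. Re ((E (B k) *\<^sub>v v) \<bullet>c v)) = 1"
    by (simp flip: Re_sum)
  moreover have "0 \<le> Re ((E (B K) *\<^sub>v v) \<bullet>c v)"
    using E B[of K] v(1) by (auto simp: povm_def positive_op_def less_eq_complex_def)
  ultimately show ?thesis by (simp add: B_def)
qed

section \<open>Arcs on the circle\<close>

text \<open>A strict bound on an infimum is witnessed by some k, without showing that the infimum is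
  attained. This is why the separation arguments use a radius e strictly above \<delta>.\<close>

lemma circle_dist_less_iff:
  "circle_dist x y < e \<longleftrightarrow> (\<exists>k::int. \<bar>x - y + 2 * pi * of_int k\<bar> < e)"
  unfolding circle_dist_def by (subst cINF_less_iff) (auto intro: bdd_belowI[of _ 0])

definition angle_ball :: "real \<Rightarrow> real \<Rightarrow> real set" where
  "angle_ball \<delta> \<theta> = {t \<in> {0..<2 * pi}. circle_dist t \<theta> \<le> \<delta>}"

lemma sets_angle_ball: "angle_ball \<delta> \<theta> \<in> sets angle_space"
proof -
  have "(\<lambda>t. circle_dist t \<theta>) \<in> borel_measurable borel"
    unfolding circle_dist_def by measurable
  then have "{t. circle_dist t \<theta> \<le> \<delta>} \<in> sets borel" by simp
  then show ?thesis
    unfolding angle_space_def sets_restrict_space angle_ball_def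
    by (intro image_eqI[of _ _ "{t. circle_dist t \<theta> \<le> \<delta>}"]) auto
qed

lemma angle_ball_disjointI:
  assumes "\<delta> < e" and "\<And>m::int. 2 * e \<le> \<bar>\<alpha> - \<beta> + 2 * pi * of_int m\<bar>"
  shows "angle_ball \<delta> \<alpha> \<inter> angle_ball \<delta> \<beta> = {}"
proof (rule ccontr)
  assume "angle_ball \<delta> \<alpha> \<inter> angle_ball \<delta> \<beta> \<noteq> {}"
  then obtain t where "circle_dist t \<alpha> < e" "circle_dist t \<beta> < e"
    using assms(1) by (auto simp: angle_ball_def intro: le_less_trans)
  then obtain k l :: int where "\<bar>t - \<alpha> + 2 * pi * of_int k\<bar> < e" "\<bar>t - \<beta> + 2 * pi * of_int l\<bar> < e"
    unfolding circle_dist_less_iff by auto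
  then have "\<bar>\<alpha> - \<beta> + 2 * pi * of_int (l - k)\<bar> < 2 * e"
    by (simp add: algebra_simps)
  then show False using assms(2)[of "l - k"] by simp
qed

lemma unit_vec_cscalar_prod_self: "i < n \<Longrightarrow> unit_vec n i \<bullet>c unit_vec n i = (1::complex)"
  by (simp add: scalar_prod_left_unit)

lemma kron_vec_unit_vec:
  assumes "0 < m" "0 < n"
  shows "kron_vec (unit_vec m 0) (unit_vec n 0) = unit_vec (m * n) 0"
proof (rule eq_vecI)
  fix i assume "i < dim_vec (unit_vec (m * n) 0 :: complex Matrix.vec)"
  then have i: "i < m * n" by simp
  then have "i div n < m" "i mod n < n" using assms by (auto simp: less_mult_imp_div_less)
  moreover have "i = 0 \<longleftrightarrow> i div n = 0 \<and> i mod n = 0"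
    by (metis div_mult_mod_eq div_0 mod_0 add_0 mult_0)
  ultimately show "vec_index (kron_vec (unit_vec m 0) (unit_vec n 0)) i = vec_index (unit_vec (m * n) 0) i"
    using i assms by (auto simp: kron_vec_def unit_vec_def)
qed (simp add: kron_vec_def)

section \<open>Outcome probabilities as functions of the phase\<close>

definition phase_prob :: "nat \<Rightarrow> query_alg \<Rightarrow> real set \<Rightarrow> real \<Rightarrow> real" where
  "phase_prob N \<A> S \<theta> = output_prob N \<A> (scalar_unitary N \<theta>) (unit_vec N 0) S"

context
  fixes N :: nat and \<A> :: query_alg
  assumes N: "0 < N" and alg: "query_algorithm N \<A>"
begin

lemma final_state_scalar_unitary:
  shows "final_state N \<A> (scalar_unitary N \<theta>) (unit_vec N 0) \<in> carrier_vec (N * wdim \<A>)"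
    and "final_state N \<A> (scalar_unitary N \<theta>) (unit_vec N 0) \<bullet>c
         final_state N \<A> (scalar_unitary N \<theta>) (unit_vec N 0) = 1"
    and "i < N * wdim \<A> \<Longrightarrow>
      trig_poly (cost \<A>) (\<lambda>\<theta>. vec_index (final_state N \<A> (scalar_unitary N \<theta>) (unit_vec N 0)) i)"
proof -
  have w: "0 < wdim \<A>" and gates: "\<forall>g\<in>set (gates \<A>). valid_gate N (wdim \<A>) g"
    using alg by (auto simp: query_algorithm_def)
  have "unit_vec (N * wdim \<A>) 0 \<bullet>c unit_vec (N * wdim \<A>) 0 = (1::complex)"
    using N w by (intro unit_vec_cscalar_prod_self) simp
  then show "final_state N \<A> (scalar_unitary N \<theta>) (unit_vec N 0) \<in> carrier_vec (N * wdim \<A>)"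
    "final_state N \<A> (scalar_unitary N \<theta>) (unit_vec N 0) \<bullet>c
         final_state N \<A> (scalar_unitary N \<theta>) (unit_vec N 0) = 1"
    "i < N * wdim \<A> \<Longrightarrow>
      trig_poly (cost \<A>) (\<lambda>\<theta>. vec_index (final_state N \<A> (scalar_unitary N \<theta>) (unit_vec N 0)) i)"
    using run_gates[OF gates unit_vec_carrier, of 0]
    unfolding final_state_def kron_vec_unit_vec[OF N w] cost_def by auto
qed

lemma povm_meas: "povm angle_space (N * wdim \<A>) (meas \<A>)"
  using alg by (simp add: query_algorithm_def)

text \<open>Positivity makes the quadratic form real, so taking \<open>Re\<close> in
  \<open>output_prob\<close> loses nothing and the probability can be treated as a complex
  trigonometric polynomial.\<close>

lemma meas_quadratic_form:
  assumes "S \<in> sets angle_space"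
  shows "0 \<le> phase_prob N \<A> S \<theta>"
    and "complex_of_real (phase_prob N \<A> S \<theta>) =
      (meas \<A> S *\<^sub>v final_state N \<A> (scalar_unitary N \<theta>) (unit_vec N 0)) \<bullet>c
        final_state N \<A> (scalar_unitary N \<theta>) (unit_vec N 0)"
proof -
  have "positive_op (N * wdim \<A>) (meas \<A> S)"
    using povm_meas assms unfolding povm_def by (rule conjunct1[THEN bspec])
  then have "0 \<le> (meas \<A> S *\<^sub>v final_state N \<A> (scalar_unitary N \<theta>) (unit_vec N 0)) \<bullet>c
        final_state N \<A> (scalar_unitary N \<theta>) (unit_vec N 0)"
    unfolding positive_op_def by (rule conjunct2[THEN bspec]) (rule final_state_scalar_unitary(1))
  then show "0 \<le> phase_prob N \<A> S \<theta>" "complex_of_real (phase_prob N \<A> S \<theta>) =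
      (meas \<A> S *\<^sub>v final_state N \<A> (scalar_unitary N \<theta>) (unit_vec N 0)) \<bullet>c
        final_state N \<A> (scalar_unitary N \<theta>) (unit_vec N 0)"
    by (auto simp: phase_prob_def output_prob_def Let_def less_eq_complex_def complex_eq_iff)
qed

text \<open>Each term pairs an amplitude with a conjugate amplitude, both of degree at most the
  cost, whence the factor 2.\<close>

lemma trig_poly_phase_prob:
  assumes S: "S \<in> sets angle_space"
  shows "trig_poly (2 * cost \<A>) (\<lambda>\<theta>. complex_of_real (phase_prob N \<A> S \<theta>))"
proof -
  let ?\<phi> = "\<lambda>\<theta>. final_state N \<A> (scalar_unitary N \<theta>) (unit_vec N 0)"
  have E: "meas \<A> S \<in> carrier_mat (N * wdim \<A>) (N * wdim \<A>)"
    using povm_meas S by (auto simp: povm_def positive_op_def)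
  have "trig_poly (2 * cost \<A>)
      (\<lambda>\<theta>. meas \<A> S $$ (i, j) * vec_index (?\<phi> \<theta>) j * cnj (vec_index (?\<phi> \<theta>) i))"
    if "i < N * wdim \<A>" "j < N * wdim \<A>" for i j
    using trig_poly_mult[OF trig_poly_mult[OF trig_poly_const[of 0] final_state_scalar_unitary(3)[OF that(2)]]
        trig_poly_cnj[OF final_state_scalar_unitary(3)[OF that(1)]]]
    by (simp add: mult_2)
  then show ?thesis
    unfolding meas_quadratic_form(2)[OF S] quadratic_form_sum[OF E final_state_scalar_unitary(1)]
    by (intro trig_poly_sum) auto
qed

lemma phase_prob_sum_le:
  fixes S :: "nat \<Rightarrow> real set"
  assumes "\<And>k. k < K \<Longrightarrow> S k \<in> sets angle_space" "disjoint_family_on S {..<K}"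
  shows "(\<Sum>k<K. phase_prob N \<A> (S k) \<theta>) \<le> 1"
  using povm_prob_sum_le[OF povm_meas assms final_state_scalar_unitary(1,2)]
  by (simp add: phase_prob_def output_prob_def Let_def)

lemma phase_prob_disjoint:
  assumes "S \<in> sets angle_space" "S' \<in> sets angle_space" "S \<inter> S' = {}"
  shows "phase_prob N \<A> S \<theta> + phase_prob N \<A> S' \<theta> \<le> 1"
proof -
  have "(\<Sum>k<2::nat. phase_prob N \<A> (if k = 0 then S else S') \<theta>) \<le> 1"
    by (rule phase_prob_sum_le) (use assms in \<open>auto simp: disjoint_family_on_def\<close>)
  then show ?thesis by (simp add: numeral_2_eq_2)
qed

section \<open>The two bounds on the cost\<close>

context
  fixes \<epsilon> \<delta> :: real
  assumes solves: "solves_QPE N \<delta> \<epsilon> \<A>"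
begin

lemma phase_prob_angle_ball:
  assumes "0 \<le> \<theta>" "\<theta> < 2 * pi"
  shows "1 - \<epsilon> \<le> phase_prob N \<A> (angle_ball \<delta> \<theta>) \<theta>"
proof -
  have "unit_vec N 0 \<bullet>c unit_vec N 0 = (1::complex)"
    using N by (rule unit_vec_cscalar_prod_self)
  then show ?thesis
    using solves assms unitary_scalar_unitary[of N \<theta>] scalar_unitary_mult_vec[OF unit_vec_carrier[of N 0], of \<theta>]
    unfolding solves_QPE_def phase_prob_def angle_ball_def by auto
qed

text \<open>If \<open>cos \<theta> \<le> cos (2 * e)\<close>, then \<theta> is at distance at least
  \<open>2 * e\<close> from 0 on the circle, so the arcs around the two are disjoint. Being correct
  at \<theta> leaves at most \<epsilon> for the arc around 0.\<close>

lemma cost_concentration_bound: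
  assumes \<delta>: "0 < \<delta>" "\<delta> < e" "e < pi / 3"
  shows "1 - \<epsilon> \<le> \<epsilon> * exp (real (2 * cost \<A>) * (4 * e))"
proof -
  have "phase_prob N \<A> (angle_ball \<delta> 0) \<theta> \<le> \<epsilon>" if cos: "cos \<theta> \<le> cos (2 * e)" for \<theta>
  proof -
    \<comment> \<open>The polynomial estimate concerns all real \<theta>, the promise only
      \<open>[0, 2 * pi)\<close>. Reducing modulo \<open>2 * pi\<close> leaves the input unitary
      unchanged.\<close>
    define \<theta>' where "\<theta>' = 2 * pi * frac (\<theta> / (2 * pi))"
    have \<theta>': "0 \<le> \<theta>'" "\<theta>' < 2 * pi"
      using frac_lt_1[of "\<theta> / (2 * pi)"] by (auto simp: \<theta>'_def)
    have "\<theta> = \<theta>' + 2 * pi * of_int \<lfloor>\<theta> / (2 * pi)\<rfloor>"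
      by (simp add: \<theta>'_def frac_def field_simps)
    then have cis: "cis \<theta> = cis \<theta>'"
      by (metis cis_mult cis_multiple_2pi Ints_of_int mult.right_neutral)
    then have "cos \<theta>' = cos \<theta>" by (simp add: complex_eq_iff)
    have "angle_ball \<delta> \<theta>' \<inter> angle_ball \<delta> 0 = {}"
    proof (rule angle_ball_disjointI[OF \<delta>(2)], rule ccontr)
      fix m :: int assume "\<not> 2 * e \<le> \<bar>\<theta>' - 0 + 2 * pi * of_int m\<bar>"
      then have "cos (2 * e) < cos \<bar>\<theta>' + 2 * pi * of_int m\<bar>"
        using \<delta> by (intro cos_monotone_0_pi) auto
      also have "cos \<bar>\<theta>' + 2 * pi * of_int m\<bar> = cos (\<theta>' + 2 * pi * of_int m)"
        by (rule cos_abs_real)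
      also have "\<dots> = cos \<theta>"
        using \<open>cos \<theta>' = cos \<theta>\<close> by (simp add: cos_add)
      finally show False using cos by simp
    qed
    then have "phase_prob N \<A> (angle_ball \<delta> \<theta>') \<theta>' + phase_prob N \<A> (angle_ball \<delta> 0) \<theta>' \<le> 1"
      by (intro phase_prob_disjoint sets_angle_ball)
    moreover have "phase_prob N \<A> (angle_ball \<delta> 0) \<theta> = phase_prob N \<A> (angle_ball \<delta> 0) \<theta>'"
      by (simp add: phase_prob_def scalar_unitary_def cis)
    ultimately show ?thesis using phase_prob_angle_ball[OF \<theta>'] by simp
  qed
  then have "phase_prob N \<A> (angle_ball \<delta> 0) 0 \<le> \<epsilon> * exp (real (2 * cost \<A>) * (4 * e))"
    using \<delta> by (intro trig_poly_concentration trig_poly_phase_prob meas_quadratic_form(1) sets_angle_ball) auto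
  then show ?thesis using phase_prob_angle_ball[of 0] by simp
qed

lemma cost_packing_bound:
  assumes K: "0 < K" "\<delta> < pi / real K"
  shows "real K * (1 - \<epsilon>) \<le> 2 * real (cost \<A>) + 1"
proof -
  define \<alpha> where "\<alpha> j = 2 * pi * real j / real K" for j
  have \<alpha>: "0 \<le> \<alpha> j" "\<alpha> j < 2 * pi" if "j < K" for j
    using that by (auto simp: \<alpha>_def field_simps)
  have "angle_ball \<delta> (\<alpha> i) \<inter> angle_ball \<delta> (\<alpha> j) = {}" if "i < K" "j < K" "i \<noteq> j" for i j
  proof (rule angle_ball_disjointI[OF K(2)])
    fix m :: int
    \<comment> \<open>Distinct indices below K are incongruent modulo K, so this integer has
      absolute value at least 1. Scaled by \<open>2 * pi / K\<close>, it is the difference of the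
      centres up to full turns.\<close>
    have "int i - int j + m * int K \<noteq> 0"
    proof
      assume "int i - int j + m * int K = 0"
      then have "int j = int i + m * int K" by simp
      then have "int j mod int K = int i mod int K" by simp
      then show False using that by simp
    qed
    then have "1 \<le> \<bar>int i - int j + m * int K\<bar>" by linarith
    then have "1 \<le> \<bar>real_of_int (int i - int j + m * int K)\<bar>"
      by (simp only: of_int_abs[symmetric] of_int_1_le_iff)
    then have "2 * (pi / real K) * 1 \<le> 2 * (pi / real K) * \<bar>of_int (int i - int j + m * int K)\<bar>"
      by (intro mult_left_mono) auto
    also have "\<dots> = \<bar>2 * (pi / real K) * of_int (int i - int j + m * int K)\<bar>"
      by (simp add: abs_mult)
    also have "2 * (pi / real K) * of_int (int i - int j + m * int K) = \<alpha> i - \<alpha> j + 2 * pi * of_int m"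
      using K(1) by (simp add: \<alpha>_def field_simps)
    finally show "2 * (pi / real K) \<le> \<bar>\<alpha> i - \<alpha> j + 2 * pi * of_int m\<bar>" by simp
  qed
  then have dis: "disjoint_family_on (\<lambda>j. angle_ball \<delta> (\<alpha> j)) {..<K}"
    by (auto simp: disjoint_family_on_def)
  have "real K * (1 - \<epsilon>) = (\<Sum>j<K. 1 - \<epsilon>)" by simp
  also have "\<dots> \<le> (\<Sum>j<K. phase_prob N \<A> (angle_ball \<delta> (\<alpha> j)) (\<alpha> j))"
    using \<alpha> by (intro sum_mono phase_prob_angle_ball) auto
  also have "\<dots> \<le> real (2 * cost \<A>) + 1"
    by (intro trig_poly_packing trig_poly_phase_prob meas_quadratic_form(1) phase_prob_sum_le
        sets_angle_ball dis)
  finally show ?thesis by simp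
qed

text \<open>With T the cost, concentration gives
  \<open>log 2 (1 / \<epsilon>) \<le> 100 / 3 * T * \<delta>\<close> for small \<epsilon>. For the
  rest the logarithm is at most 2 and packing gives \<open>pi \<le> 7 * T * \<delta>\<close>. The
  constant 48 covers both.\<close>

lemma cost_lower_bound:
  assumes \<epsilon>: "0 < \<epsilon>" "\<epsilon> < 1 / 2" and \<delta>: "0 < \<delta>" "\<delta> < 1"
  shows "1 / 48 * (1 / \<delta>) * log 2 (1 / \<epsilon>) \<le> real (cost \<A>)"
proof (cases "\<epsilon> \<le> 1 / 4")
  case True
  \<comment> \<open>The factor 25/24 lies strictly between 1 and pi/3, so \<delta> < e, and \<delta>
    < 1 gives e < pi/3.\<close>
  define e where "e = 25 / 24 * \<delta>"
  define L where "L = log 2 (1 / \<epsilon>)"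
  have "1 / 2 \<le> \<epsilon> * exp (real (2 * cost \<A>) * (4 * e))"
    using cost_concentration_bound[of e] \<epsilon> \<delta> pi_approx(1) by (simp add: e_def)
  then have "1 / (2 * \<epsilon>) \<le> exp (real (2 * cost \<A>) * (4 * e))"
    using \<epsilon> by (simp add: field_simps)
  then have "ln (1 / (2 * \<epsilon>)) \<le> real (2 * cost \<A>) * (4 * e)"
    using \<epsilon> by (subst exp_le_cancel_iff[symmetric]) simp
  moreover have "ln (1 / (2 * \<epsilon>)) = ln 2 * (L - 1)"
    using \<epsilon> by (simp add: L_def log_def ln_div ln_mult field_simps)
  ultimately have 1: "ln 2 * (L - 1) \<le> 25 / 3 * (real (cost \<A>) * \<delta>)"
    by (simp add: e_def ac_simps)
  \<comment> \<open>Here \<epsilon> at most 1/4 is used: L is at least 2, so the 1 subtracted from L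
    costs at most half of it.\<close>
  have "log 2 4 \<le> L"
    unfolding L_def using \<epsilon> True by (subst log_le_cancel_iff) (auto simp: field_simps)
  then have L: "2 \<le> L"
    using log_pow_cancel[of 2 2] by simp
  have "1 / 2 * (L / 2) \<le> ln 2 * (L - 1)"
    using L ln2_ge_two_thirds by (intro mult_mono) auto
  then have "L \<le> 100 / 3 * (real (cost \<A>) * \<delta>)" using 1 by simp
  moreover have "0 \<le> real (cost \<A>) * \<delta>" using \<delta> by simp
  ultimately have "L \<le> 48 * (real (cost \<A>) * \<delta>)" by linarith
  then show ?thesis using \<delta> by (simp add: L_def field_simps)
next
  case False
  \<comment> \<open>The largest integer strictly below pi/\<delta>; strictness gives \<delta> <
    pi/K, even if pi/\<delta> is an integer.\<close>
  define K where "K = nat (\<lceil>pi / \<delta>\<rceil> - 1)"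
  have "3 < pi / \<delta>"
    using \<delta> pi_gt3 by (simp add: field_simps)
  then have "3 < \<lceil>pi / \<delta>\<rceil>" by (simp add: less_ceiling_iff)
  then have "real K = of_int \<lceil>pi / \<delta>\<rceil> - 1" "3 \<le> real K"
    unfolding K_def by auto
  then have K: "3 \<le> real K" "real K < pi / \<delta>" "pi / \<delta> \<le> real K + 1"
    using ceiling_correct[of "pi / \<delta>"] by auto
  then have "0 < K" "\<delta> < pi / real K" using \<delta> by (auto simp: field_simps)
  then have "real K * (1 - \<epsilon>) \<le> 2 * real (cost \<A>) + 1"
    by (rule cost_packing_bound)
  moreover have "real K * (1 / 2) < real K * (1 - \<epsilon>)"
    using \<epsilon> K by (intro mult_strict_left_mono) auto
  ultimately have c: "real K < 4 * real (cost \<A>) + 2" by simp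
  \<comment> \<open>K is at least 3, so \<open>K < 4 * T + 2\<close> rules out T = 0. Then
    \<open>pi / \<delta> \<le> K + 1 < 4 * T + 3 \<le> 7 * T\<close>.\<close>
  then have "cost \<A> \<noteq> 0" using K(1) by auto
  then have "1 \<le> real (cost \<A>)" by simp
  then have "pi / \<delta> \<le> 7 * real (cost \<A>)" using K c by linarith
  then have 1: "pi \<le> 7 * (real (cost \<A>) * \<delta>)" using \<delta> by (simp add: field_simps)
  have "log 2 (1 / \<epsilon>) \<le> log 2 4"
    using \<epsilon> False by (subst log_le_cancel_iff) (auto simp: field_simps)
  also have "\<dots> = 2" using log_pow_cancel[of 2 2] by simp
  finally have "log 2 (1 / \<epsilon>) \<le> 48 * (real (cost \<A>) * \<delta>)" using 1 pi_gt3 by linarith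
  then show ?thesis using \<delta> by (simp add: field_simps)
qed

end

end

theorem theorem1p3:
  shows "\<exists>c::real. c > 0 \<and>
    (\<forall>(N::nat) (\<epsilon>::real) (\<delta>::real) \<A>.
       N \<ge> 2 \<and> 0 < \<epsilon> \<and> \<epsilon> < 1 / 2 \<and> 0 < \<delta> \<and> \<delta> < 1 \<and>
       query_algorithm N \<A> \<and> solves_QPE N \<delta> \<epsilon> \<A> \<longrightarrow>
       real (cost \<A>) \<ge> c * (1 / \<delta>) * log 2 (1 / \<epsilon>))"
proof (intro exI[of _ "1 / 48"] conjI allI impI)
  fix N :: nat and \<epsilon> \<delta> :: real and \<A>
  assume *: "N \<ge> 2 \<and> 0 < \<epsilon> \<and> \<epsilon> < 1 / 2 \<and> 0 < \<delta> \<and> \<delta> < 1 \<and>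
    query_algorithm N \<A> \<and> solves_QPE N \<delta> \<epsilon> \<A>"
  then have "0 < N" by simp
  then show "real (cost \<A>) \<ge> 1 / 48 * (1 / \<delta>) * log 2 (1 / \<epsilon>)"
    using * by (elim conjE) (rule cost_lower_bound)
qed simp

end
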